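(* Let $\Theta\subseteq\mathbb{R}^n$ be a non-empty closed convex set with $0\notin\Theta$. Let $(X_1,x_1),\dots,(X_T,x_T)$ be i.i.d. from a distribution $\mathcal{D}$ over pairs $(X,x)$ with $X\subseteq\mathbb{R}^n$ non-empty and compact and $x\in X$. Let $\hat c_1,\dots,\hat c_T\in\Theta$ be computed by any online convex optimization algorithm (so $\hat c_t$ depends only on $\{(X_i,x_i)\}_{i=1}^{t-1}$) such that the regret $$R^{\mathrm{sub}}_T=\sum_{t=1}^T\left(\ell^{\mathrm{sub}}_{X_t,x_t}(\hat c_t)-\ell^{\mathrm{sub}}_{X_t,x_t}(c^* )\right)$$ is bounded. Then, for any $c^*\in\Theta$, the average prediction $\hat c=\frac1T\sum_{t=1}^T\hat c_t$ satisfies $$\mathbb{E}\left[\ell^{\mathrm{sub}}_{X,x}(\hat c)\right]\le\mathbb{E}_{(X,x)\sim\mathcal{D}}\left[\ell^{\mathrm{sub}}_{X,x}(c^* )\right]+\mathbb{E}\left[\frac{R^{\mathrm{sub}}_T}{T}\right],$$ where the expectation on the left-hand side is over $\{(X_t,x_t)\}_{t=1}^T\sim\mathcal{D}^T$ and an independent $(X,x)\sim\mathcal{D}$. Specifically, let $\|\cdot\|$ be a norm on $\mathbb{R}^n$ with dual norm $\|\cdot\|_\star$, let $\lambda,B,K>0$, let $\psi\colon\Theta\to\mathbb{R}$ be differentiable and $\lambda$-strongly convex with respect to $\|\cdot\|_\star$, and assume $\max\left\{2^{5/2}\lambda\max_{c,c'\in\Theta}\|c-c'\|_\star^2,\ \max_{c,c'\in\Theta}\left(\psi(c)-\psi(c')\right)\right\}\le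 B^2$. If $\hat c_1,\dots,\hat c_T$ are the outputs of the FTRL algorithm with $\beta_t=\frac{2^{1/4}}{B}\sqrt{\frac1\lambda\sum_{i=1}^{t-1}\|g_i\|^2}$ and $\|g_t\|\le K$ for $t=1,\dots,T$, then for any $c^*\in\Theta$ $$\mathbb{E}\left[\ell^{\mathrm{sub}}_{X,x}(\hat c)\right]-\mathbb{E}_{(X,x)\sim\mathcal{D}}\left[\ell^{\mathrm{sub}}_{X,x}(c^* )\right]=O\left(\frac{KB}{\sqrt{T\lambda}}\right),$$ where $O(\cdot)$ hides an absolute constant.
   Context: $\langle\cdot,\cdot\rangle$ is the standard inner product on $\mathbb{R}^n$. For non-empty compact $X\subseteq\mathbb{R}^n$, $x\in X$ and $c\in\mathbb{R}^n$, the suboptimality loss is $\ell^{\mathrm{sub}}_{X,x}(c)=\max_{x'\in X}\langle c,x'\rangle-\langle c,x\rangle$. No optimality of $x$ for $c^*$ is assumed. All random quantities are understood to be measurable and the expectations appearing are understood to exist. FTRL algorithm: for $t=1,\dots,T$, output $\hat c_t\in\arg\min_{c\in\Theta}\ \beta_t\psi(c)+\sum_{i=1}^{t-1}\langle g_i,c\rangle$, where $\hat c_1\in\Theta$ is arbitrary (deterministic) and $\hat c_t=\hat c_{t-1}$ if $g_{t-1}=0$; then observe $(X_t,x_t)$; compute any $\hat x_t\in\arg\max_{x'\in X_t}\langle\hat c_t,x'\rangle$; set $g_t=\hat x_t-x_t$. *)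

theory Defs
  imports "HOL-Probability.Probability"
begin

text \<open>For non-empty compact \<open>X\<close> the supremum is the maximum; it is junk for unbounded \<open>X\<close>.\<close>

definition subopt_loss :: "'a::euclidean_space set \<Rightarrow> 'a \<Rightarrow> 'a \<Rightarrow> real" where
  "subopt_loss X x c = (SUP x'\<in>X. c \<bullet> x') - c \<bullet> x"

definition is_norm :: "('a::real_vector \<Rightarrow> real) \<Rightarrow> bool" where
  "is_norm N \<longleftrightarrow>
     (\<forall>x. 0 \<le> N x) \<and> (\<forall>x. N x = 0 \<longleftrightarrow> x = 0) \<and>
     (\<forall>a x. N (a *\<^sub>R x) = \<bar>a\<bar> * N x) \<and> (\<forall>x y. N (x + y) \<le> N x + N y)"

definition dual_norm :: "('a::real_inner \<Rightarrow> real) \<Rightarrow> 'a \<Rightarrow> real" where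
  "dual_norm N c = (SUP x\<in>{x. N x \<le> 1}. c \<bullet> x)"

definition strongly_convex_on ::
    "('a::real_vector \<Rightarrow> real) \<Rightarrow> real \<Rightarrow> 'a set \<Rightarrow> ('a \<Rightarrow> real) \<Rightarrow> bool" where
  "strongly_convex_on N lam S f \<longleftrightarrow>
     convex S \<and>
     (\<forall>x\<in>S. \<forall>y\<in>S. \<forall>u\<in>{0..1}.
        f (u *\<^sub>R x + (1 - u) *\<^sub>R y)
          \<le> u * f x + (1 - u) * f y - lam / 2 * u * (1 - u) * (N (x - y))\<^sup>2)"

text \<open>A deterministic online algorithm with outputs in \<open>\<Theta>\<close> is a family of maps whose \<open>t\<close>-th
  member takes only the first \<open>t - 1\<close> observations, as a point of
  \<open>PiM {1..<t} (\<lambda>_. D)\<close>. The codomain \<open>restrict_space borel \<Theta>\<close> expresses both measurability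
  and membership in \<open>\<Theta>\<close>.\<close>

definition online_algorithm ::
    "'a::euclidean_space set \<Rightarrow> ('a set \<times> 'a) measure \<Rightarrow> nat
      \<Rightarrow> (nat \<Rightarrow> (nat \<Rightarrow> 'a set \<times> 'a) \<Rightarrow> 'a) \<Rightarrow> bool" where
  "online_algorithm \<Theta> D T A \<longleftrightarrow>
     (\<forall>t\<in>{1..T}. A t \<in> PiM {1..<t} (\<lambda>_. D) \<rightarrow>\<^sub>M restrict_space borel \<Theta>)"

definition prediction ::
    "(nat \<Rightarrow> (nat \<Rightarrow> 'a set \<times> 'a) \<Rightarrow> 'a) \<Rightarrow> (nat \<Rightarrow> 'a set \<times> 'a) \<Rightarrow> nat \<Rightarrow> 'a" where
  "prediction A \<omega> t = A t (restrict \<omega> {1..<t})"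

definition avg_prediction ::
    "(nat \<Rightarrow> (nat \<Rightarrow> 'a::real_vector set \<times> 'a) \<Rightarrow> 'a) \<Rightarrow> nat \<Rightarrow> (nat \<Rightarrow> 'a set \<times> 'a) \<Rightarrow> 'a" where
  "avg_prediction A T \<omega> = (1 / real T) *\<^sub>R (\<Sum>t=1..T. prediction A \<omega> t)"

definition regret_sub ::
    "(nat \<Rightarrow> (nat \<Rightarrow> 'a::euclidean_space set \<times> 'a) \<Rightarrow> 'a) \<Rightarrow> 'a \<Rightarrow> nat
      \<Rightarrow> (nat \<Rightarrow> 'a set \<times> 'a) \<Rightarrow> real" where
  "regret_sub A cstar T \<omega> =
     (\<Sum>t=1..T. subopt_loss (fst (\<omega> t)) (snd (\<omega> t)) (prediction A \<omega> t)
               - subopt_loss (fst (\<omega> t)) (snd (\<omega> t)) cstar)"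

text \<open>One realization of FTRL with regularization weights \<open>\<beta>\<close>: \<open>\<omega>\<close> is the observed sequence of
  pairs, \<open>chat\<close> the sequence of outputs and \<open>xhat\<close> that of the computed maximizers. When
  \<open>\<beta> 1 = 0\<close>, the argmin condition at \<open>t = 1\<close> says only that \<open>chat 1 \<in> \<Theta>\<close>.\<close>

definition is_ftrl_run ::
    "'a::euclidean_space set \<Rightarrow> ('a \<Rightarrow> real) \<Rightarrow> (nat \<Rightarrow> real) \<Rightarrow> nat
      \<Rightarrow> (nat \<Rightarrow> 'a set \<times> 'a) \<Rightarrow> (nat \<Rightarrow> 'a) \<Rightarrow> (nat \<Rightarrow> 'a) \<Rightarrow> bool" where
  "is_ftrl_run \<Theta> \<psi> \<beta> T \<omega> chat xhat \<longleftrightarrow>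
     (\<forall>t\<in>{1..T}.
        is_arg_min (\<lambda>c. \<beta> t * \<psi> c + (\<Sum>i=1..<t. (xhat i - snd (\<omega> i)) \<bullet> c)) (\<lambda>c. c \<in> \<Theta>) (chat t) \<and>
        (2 \<le> t \<and> xhat (t - 1) - snd (\<omega> (t - 1)) = 0 \<longrightarrow> chat t = chat (t - 1)) \<and>
        is_arg_max (\<lambda>x'. chat t \<bullet> x') (\<lambda>x'. x' \<in> fst (\<omega> t)) (xhat t))"

definition ftrl_beta :: "('a \<Rightarrow> real) \<Rightarrow> real \<Rightarrow> real \<Rightarrow> (nat \<Rightarrow> 'a) \<Rightarrow> nat \<Rightarrow> real" where
  "ftrl_beta N lam B g t = 2 powr (1/4) / B * sqrt (1 / lam * (\<Sum>i=1..<t. (N (g i))\<^sup>2))"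

end

theory Submission imports Defs
begin

text \<open>Since the prediction \<open>c\<^sub>t\<close> depends only on the first \<open>t - 1\<close> pairs, its expected loss on the
  \<open>t\<close>-th pair equals its expected loss on a fresh pair. Averaging over \<open>t\<close> and using Jensen's
  inequality for the convex loss bounds the expected loss of the average prediction by the expected
  average online loss, which is the expected loss of \<open>c\<^sup>*\<close> plus the expected average regret.

  For FTRL the regret is at most \<open>\<Sum> \<langle>g\<^sub>t, c\<^sub>t - c\<^sup>*\<rangle>\<close>. After shifting \<open>\<psi>\<close> to have infimum 0, this
  is at most \<open>\<beta>\<^bsub>T+1\<^esub> \<psi>(c\<^sup>*)\<close> plus stability terms. Writing \<open>S\<close> for the sum of the squared norms of
  the earlier subgradients, \<open>a\<close> for the norm of \<open>g\<^sub>t\<close> and \<open>k = B / (2\<^bsup>5/4\<^esup> \<surd>\<lambda>)\<close>, the \<open>t\<close>-th stability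
  term is at most \<open>k * min a (a\<^sup>2 / \<surd>S)\<close>: the first bound comes from the diameter of \<open>\<Theta>\<close>, the second
  from strong convexity. This telescopes against \<open>\<surd>(S + a\<^sup>2) - \<surd>S\<close>, and both contributions are at
  most \<open>2\<^bsup>1/4\<^esup> B \<surd>(\<Sum> \<parallel>g\<^sub>t\<parallel>\<^sup>2 / \<lambda>)\<close>.\<close>

section \<open>Norms and dual norms in finite dimension\<close>

lemma is_norm_zero: "is_norm N \<Longrightarrow> N 0 = 0"
  by (simp add: is_norm_def)

text \<open>\<open>N\<close> is Lipschitz with respect to the Euclidean norm, hence attains its
  minimum on the compact unit sphere, and that minimum is positive. The unit ball of
  \<open>N\<close> is therefore bounded, so that the supremum in \<open>dual_norm\<close> is a
  genuine one.\<close>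

lemma is_norm_lower_bound:
  fixes N :: "'a::euclidean_space \<Rightarrow> real"
  assumes N: "is_norm N"
  obtains m where "m > 0" "\<And>x. m * norm x \<le> N x"
proof -
  define M where "M = (\<Sum>b\<in>Basis. N b)"
  have N0: "0 \<le> N x" "N x = 0 \<longleftrightarrow> x = 0" "N (a *\<^sub>R x) = \<bar>a\<bar> * N x" "N (x + y) \<le> N x + N y" for a x y
    using N unfolding is_norm_def by auto
  have sumN: "N (\<Sum>b\<in>S. f b) \<le> (\<Sum>b\<in>S. N (f b))" if "finite S" for S :: "'a set" and f
    using that
  proof (induction S rule: finite_induct)
    case empty
    then show ?case by (simp add: is_norm_zero[OF N])
  next
    case (insert b S)
    then show ?case using N0(4)[of "f b" "sum f S"] by simp
  qed
  have up: "N x \<le> M * norm x" for x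
  proof -
    have "N x = N (\<Sum>b\<in>Basis. (x \<bullet> b) *\<^sub>R b)" by (simp add: euclidean_representation)
    also have "\<dots> \<le> (\<Sum>b\<in>Basis. \<bar>x \<bullet> b\<bar> * N b)"
      using sumN[of Basis "\<lambda>b. (x \<bullet> b) *\<^sub>R b"] by (simp add: N0(3))
    also have "\<dots> \<le> (\<Sum>b\<in>Basis. norm x * N b)"
      by (intro sum_mono mult_right_mono Basis_le_norm N0)
    finally show ?thesis by (simp add: M_def sum_distrib_left mult.commute)
  qed
  have "\<bar>N x - N y\<bar> \<le> M * dist x y" for x y
  proof -
    have "N (y - x) = N (x - y)" using N0(3)[of "-1" "x - y"] by simp
    then show ?thesis
      using N0(4)[of "x - y" y] N0(4)[of "y - x" x] up[of "x - y"] by (simp add: dist_norm)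
  qed
  then have "M-lipschitz_on UNIV N"
    by (intro lipschitz_onI) (auto simp: dist_real_def M_def N0 intro!: sum_nonneg)
  then have cont: "continuous_on (sphere 0 1) N"
    using lipschitz_on_continuous_on continuous_on_subset by blast
  have ne: "sphere (0::'a) 1 \<noteq> {}" by simp
  obtain z where z: "z \<in> sphere 0 1" "\<And>y. y \<in> sphere 0 1 \<Longrightarrow> N z \<le> N y"
    using continuous_attains_inf[OF compact_sphere ne cont] by blast
  have "z \<noteq> 0" using z(1) by auto
  have "N z > 0" using N0(1)[of z] N0(2)[of z] \<open>z \<noteq> 0\<close> by linarith
  moreover have "N z * norm x \<le> N x" for x
  proof (cases "x = 0")
    case False
    have "N z \<le> N ((1 / norm x) *\<^sub>R x)" using False by (intro z(2)) simp
    also have "\<dots> = N x / norm x" using False by (simp add: N0(3))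
    finally show ?thesis using False by (simp add: field_simps)
  qed (simp add: N0(1))
  ultimately show ?thesis using that by blast
qed

lemma bdd_above_dual_norm:
  fixes N :: "'a::euclidean_space \<Rightarrow> real"
  assumes "is_norm N"
  shows "bdd_above ((\<lambda>x. c \<bullet> x) ` {x. N x \<le> 1})"
proof -
  obtain m where m: "m > 0" "\<And>x. m * norm x \<le> N x" using is_norm_lower_bound[OF assms] by blast
  show ?thesis
  proof (rule bdd_aboveI2)
    fix x assume "x \<in> {x. N x \<le> 1}"
    then have "norm x \<le> 1 / m" using m(2)[of x] m(1) by (simp add: field_simps)
    then have "norm c * norm x \<le> norm c * (1 / m)" by (intro mult_left_mono) auto
    then show "c \<bullet> x \<le> norm c * (1 / m)"
      using norm_cauchy_schwarz[of c x] by linarith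
  qed
qed

lemma dual_norm_nonneg:
  fixes N :: "'a::euclidean_space \<Rightarrow> real"
  assumes "is_norm N"
  shows "0 \<le> dual_norm N c"
proof -
  have "0 \<in> {x. N x \<le> 1}" using assms by (simp add: is_norm_zero)
  from cSUP_upper[OF this bdd_above_dual_norm[OF assms], of c]
  show ?thesis by (simp add: dual_norm_def)
qed

lemma inner_le_dual_norm:
  fixes N :: "'a::euclidean_space \<Rightarrow> real"
  assumes N: "is_norm N"
  shows "g \<bullet> c \<le> N g * dual_norm N c"
proof (cases "g = 0")
  case True
  then show ?thesis using N by (simp add: is_norm_zero)
next
  case False
  then have pos: "N g > 0" using N unfolding is_norm_def by (metis order_le_less)
  then have "(1 / N g) *\<^sub>R g \<in> {x. N x \<le> 1}" using N by (simp add: is_norm_def)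
  from cSUP_upper[OF this bdd_above_dual_norm[OF N], of c] pos
  show ?thesis by (simp add: dual_norm_def field_simps inner_commute)
qed

text \<open>The unit ball of \<open>N\<close> is symmetric. This reconciles the difference
  \<open>u - c\<close> in the growth bound at a minimizer with the difference \<open>c - u\<close>
  in the regret.\<close>

lemma dual_norm_minus_commute:
  fixes N :: "'a::euclidean_space \<Rightarrow> real"
  assumes N: "is_norm N"
  shows "dual_norm N (x - y) = dual_norm N (y - x)"
proof -
  have Nm: "N (- z) = N z" for z
    using N unfolding is_norm_def by (metis abs_1 abs_minus_cancel mult_1 scaleR_minus1_left)
  have "{z. N z \<le> 1} = uminus ` {z. N z \<le> 1}"
    by (auto simp: Nm image_iff intro!: exI[of _ "- _"])
  then have "dual_norm N (x - y) = (SUP z\<in>uminus ` {z. N z \<le> 1}. (x - y) \<bullet> z)"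
    by (simp add: dual_norm_def)
  also have "\<dots> = dual_norm N (y - x)"
    by (simp add: dual_norm_def image_image inner_diff_left)
  finally show ?thesis .
qed

section \<open>Deterministic regret analysis of FTRL\<close>

text \<open>Quadratic growth at a minimizer: \<open>c\<close> is compared with points of the segment
  towards \<open>u\<close>, and the point tends to \<open>c\<close>. The linear term adds no
  curvature, so the modulus is \<open>lam * \<beta>\<close>.\<close>

lemma strongly_convex_arg_min:
  assumes sc: "strongly_convex_on n lam S \<psi>" and "0 \<le> \<beta>"
    and min: "is_arg_min (\<lambda>c. \<beta> * \<psi> c + v \<bullet> c) (\<lambda>c. c \<in> S) c" and u: "u \<in> S"
  shows "\<beta> * \<psi> c + v \<bullet> c + lam * \<beta> / 2 * (n (u - c))\<^sup>2 \<le> \<beta> * \<psi> u + v \<bullet> u"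
proof -
  let ?F = "\<lambda>c. \<beta> * \<psi> c + v \<bullet> c"
  have c: "c \<in> S" "\<And>y. y \<in> S \<Longrightarrow> ?F c \<le> ?F y"
    using min by (auto simp: is_arg_min_linorder)
  \<comment> \<open>Here \<open>1 - z\<close> is the weight of \<open>u\<close> in the competing
    point. Strong convexity at that point, divided by \<open>1 - z\<close>, leaves the factor
    \<open>z\<close>, which is removed by letting it tend to 1.\<close>
  have "z * (lam * \<beta> / 2 * (n (u - c))\<^sup>2) \<le> ?F u - ?F c" if z: "0 < z" "z < 1" for z
  proof -
    define s where "s = 1 - z"
    have s: "0 < s" "s \<in> {0..1}" using z by (auto simp: s_def)
    let ?w = "s *\<^sub>R u + (1 - s) *\<^sub>R c"
    have "?w \<in> S"
      using sc s c(1) u unfolding strongly_convex_on_def by (auto intro!: convexD)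
    then have "?F c \<le> ?F ?w" by (rule c(2))
    also have "\<dots> \<le> \<beta> * (s * \<psi> u + (1 - s) * \<psi> c - lam / 2 * s * (1 - s) * (n (u - c))\<^sup>2) + v \<bullet> ?w"
      using sc s c(1) u \<open>0 \<le> \<beta>\<close> unfolding strongly_convex_on_def
      by (intro add_right_mono mult_left_mono) auto
    finally have "s * (z * (lam * \<beta> / 2 * (n (u - c))\<^sup>2)) \<le> s * (?F u - ?F c)"
      by (simp add: s_def algebra_simps)
    then show ?thesis using s by simp
  qed
  from field_le_mult_one_interval[OF this] show ?thesis by simp
qed

text \<open>The induction is on the number of rounds, for all comparators \<open>u\<close> at once: the step uses the
  induction hypothesis for the next output as comparator.\<close>

lemma ftrl_regret:
  fixes g chat :: "nat \<Rightarrow> 'a::real_inner" and \<beta> \<delta> :: "nat \<Rightarrow> real"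
  assumes chat: "\<And>t. t \<in> {1..T} \<Longrightarrow> chat t \<in> S"
    and step: "\<And>t u. t \<in> {1..T} \<Longrightarrow> u \<in> S \<Longrightarrow>
        \<beta> t * \<psi> (chat t) + (\<Sum>i=1..<t. g i) \<bullet> chat t + g t \<bullet> (chat t - u)
          \<le> \<beta> t * \<psi> u + (\<Sum>i=1..<t. g i) \<bullet> u + \<delta> t"
    and beta: "0 \<le> \<beta> 1" "\<And>t. \<beta> t \<le> \<beta> (Suc t)"
    and psi: "\<And>c. c \<in> S \<Longrightarrow> 0 \<le> \<psi> c" and "u \<in> S"
  shows "(\<Sum>t=1..T. g t \<bullet> (chat t - u)) \<le> \<beta> (Suc T) * \<psi> u + (\<Sum>t=1..T. \<delta> t)"
proof -
  have "(\<Sum>t=1..m. g t \<bullet> chat t)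
      \<le> \<beta> (Suc m) * \<psi> u + (\<Sum>i=1..<Suc m. g i) \<bullet> u + (\<Sum>t=1..m. \<delta> t)"
    if "m \<le> T" "u \<in> S" for m u
    using that
  proof (induction m arbitrary: u)
    case 0
    then show ?case using beta psi by simp
  next
    case (Suc m)
    have t: "Suc m \<in> {1..T}" using Suc.prems by auto
    \<comment> \<open>Raising the regularization weight goes in the right direction because
      \<open>\<psi>\<close> is nonnegative on \<open>S\<close>; this is why the regularizer is
      shifted before the lemma is applied.\<close>
    have "\<beta> (Suc m) * \<psi> u \<le> \<beta> (Suc (Suc m)) * \<psi> u"
      using beta(2) psi Suc.prems by (intro mult_right_mono) auto
    with Suc.IH[OF _ chat[OF t]] step[OF t \<open>u \<in> S\<close>] Suc.prems show ?case
      by (simp add: inner_diff_right inner_add_left)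
  qed
  from this[OF order_refl \<open>u \<in> S\<close>] show ?thesis
    by (simp add: inner_diff_right sum_subtractf inner_sum_left atLeastLessThanSuc_atLeastAtMost)
qed

text \<open>With \<open>S = sqrt (s + a\<^sup>2)\<close> and \<open>r = sqrt s\<close>, the better
  of the two bounds is at most \<open>sqrt 2 * k * a\<^sup>2 / S\<close>, because \<open>S\<close>
  is at most \<open>sqrt 2\<close> times the larger of \<open>r\<close> and \<open>a\<close>. The
  linear bound covers \<open>s = 0\<close>. Then \<open>a\<^sup>2 = (S - r) * (S + r)\<close> and
  \<open>S + r \<le> 2 * S\<close> produce the difference.\<close>

lemma stability_telescope:
  fixes a s k \<delta> :: real
  assumes "0 \<le> a" "0 \<le> s" "0 \<le> k" and lin: "\<delta> \<le> k * a"
    and quad: "0 < s \<Longrightarrow> \<delta> \<le> k * a\<^sup>2 / sqrt s"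
  shows "\<delta> \<le> 2 * sqrt 2 * k * (sqrt (s + a\<^sup>2) - sqrt s)"
proof (cases "a = 0")
  case True
  then show ?thesis using lin by simp
next
  case False
  then have a: "a > 0" using assms by simp
  define S r where "S = sqrt (s + a\<^sup>2)" and "r = sqrt s"
  have r: "0 \<le> r" "r\<^sup>2 = s" using assms by (auto simp: r_def)
  have S: "0 < S" "S\<^sup>2 = s + a\<^sup>2" "r \<le> S"
    using assms a by (auto simp: S_def r_def add_nonneg_pos)
  have "\<delta> \<le> k * (sqrt 2 * a\<^sup>2 / S)"
  proof (cases "a\<^sup>2 \<le> s")
    case True
    then have s: "s > 0" using a by (smt (verit) zero_less_power)
    have "S\<^sup>2 \<le> (sqrt 2 * r)\<^sup>2" using True r S by (simp add: power_mult_distrib)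
    then have "S \<le> sqrt 2 * r" using r by (rule_tac power2_le_imp_le) auto
    then have "a\<^sup>2 * S \<le> a\<^sup>2 * (sqrt 2 * r)" by (intro mult_left_mono) auto
    then have "a\<^sup>2 / r \<le> sqrt 2 * a\<^sup>2 / S"
      using s S r by (auto simp: field_simps r_def)
    then have "k * (a\<^sup>2 / r) \<le> k * (sqrt 2 * a\<^sup>2 / S)" using assms by (intro mult_left_mono)
    then show ?thesis using quad[OF s] by (simp add: r_def)
  next
    case False
    have "S\<^sup>2 \<le> (sqrt 2 * a)\<^sup>2" using False S by (simp add: power_mult_distrib)
    then have "S \<le> sqrt 2 * a" using a by (rule_tac power2_le_imp_le) auto
    then have "a * S \<le> a * (sqrt 2 * a)" using a by (intro mult_left_mono) auto
    then have "a \<le> sqrt 2 * a\<^sup>2 / S" using S by (simp add: field_simps power2_eq_square)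
    then have "k * a \<le> k * (sqrt 2 * a\<^sup>2 / S)" using assms by (intro mult_left_mono)
    then show ?thesis using lin by simp
  qed
  also have "\<dots> \<le> k * (sqrt 2 * (2 * (S - r)))"
  proof -
    have "a\<^sup>2 = (S - r) * (S + r)" using S r by (simp add: algebra_simps power2_eq_square)
    also have "\<dots> \<le> (S - r) * (2 * S)" using S by (intro mult_left_mono) auto
    finally have "a\<^sup>2 / S \<le> 2 * (S - r)" using S by (simp add: field_simps)
    then have "sqrt 2 * (a\<^sup>2 / S) \<le> sqrt 2 * (2 * (S - r))" by (intro mult_left_mono) auto
    then show ?thesis using assms by (intro mult_left_mono) auto
  qed
  finally show ?thesis by (simp add: S_def r_def algebra_simps)
qed

lemma ftrl_adaptive_regret:
  fixes g chat :: "nat \<Rightarrow> 'a::euclidean_space"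
  assumes N: "is_norm N" and lam: "lam > 0" and B: "B > 0"
    and sc: "strongly_convex_on (dual_norm N) lam S \<psi>"
    and diam: "\<And>c c'. c \<in> S \<Longrightarrow> c' \<in> S \<Longrightarrow> 2 powr (5/2) * lam * (dual_norm N (c - c'))\<^sup>2 \<le> B\<^sup>2"
    and range: "\<And>c c'. c \<in> S \<Longrightarrow> c' \<in> S \<Longrightarrow> \<psi> c - \<psi> c' \<le> B\<^sup>2"
    and run: "\<And>t. t \<in> {1..T} \<Longrightarrow>
        is_arg_min (\<lambda>c. ftrl_beta N lam B g t * \<psi> c + (\<Sum>i=1..<t. g i \<bullet> c)) (\<lambda>c. c \<in> S) (chat t)"
    and u: "u \<in> S"
  shows "(\<Sum>t=1..T. g t \<bullet> (chat t - u))
    \<le> 2 powr (5/4) * B * sqrt (\<Sum>t=1..T. (N (g t))\<^sup>2) / sqrt lam"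
proof -
  define q where "q = (2::real) powr (1/4)"
  have q: "q > 0" "q\<^sup>2 = sqrt 2" "2 powr (5/4) = 2 * q" "2 powr (5/2) = 4 * q\<^sup>2"
  proof -
    show "q > 0" by (simp add: q_def)
    show q2: "q\<^sup>2 = sqrt 2"
      by (simp add: q_def power2_eq_square powr_add[symmetric] powr_half_sqrt)
    have "(2::real) powr (5/4) = 2 powr (1 + 1/4)" by simp
    then show "2 powr (5/4) = 2 * q" unfolding powr_add q_def by simp
    have "(2::real) powr (5/2) = 2 powr (2 + 1/2)" by simp
    then show "2 powr (5/2) = 4 * q\<^sup>2" unfolding powr_add q2 by (simp add: powr_half_sqrt)
  qed
  define \<beta> where "\<beta> = ftrl_beta N lam B g"
  define s where "s t = (\<Sum>i=1..<t. (N (g i))\<^sup>2)" for t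
  \<comment> \<open>This is the bound on the dual-norm diameter of \<open>S\<close>: since
    \<open>2 powr (5/2) = 4 * q\<^sup>2\<close>, the hypothesis \<open>diam\<close> says that
    distances are at most \<open>k\<close>.\<close>
  define k where "k = B / (2 * q * sqrt lam)"
  \<comment> \<open>The shift changes neither the minimizers nor differences of values, and it
    places the regularizer between 0 and \<open>B\<^sup>2\<close> on \<open>S\<close>.\<close>
  define \<phi> where "\<phi> c = \<psi> c - Inf (\<psi> ` S)" for c
  have Npos: "0 \<le> N x" for x using N by (simp add: is_norm_def)
  \<comment> \<open>The sum starts at index 1, so \<open>g 0\<close> never enters and both
    \<open>s 0\<close> and \<open>s 1\<close> are 0.\<close>
  have s: "0 \<le> s t" "s (Suc t) = s t + (if t \<ge> 1 then (N (g t))\<^sup>2 else 0)" for t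
    unfolding s_def by (auto intro: sum_nonneg)
  have beta: "\<beta> t = q * sqrt (s t) / (B * sqrt lam)" for t
    by (simp add: \<beta>_def ftrl_beta_def q_def s_def real_sqrt_divide)
  have beta_nonneg: "0 \<le> \<beta> t" for t
    using q B lam s(1)[of t] by (simp add: beta)
  have k: "k > 0" using q B lam by (simp add: k_def)
  have phi: "0 \<le> \<phi> c" "\<phi> c \<le> B\<^sup>2" if "c \<in> S" for c
  proof -
    have "bdd_below (\<psi> ` S)" using range[OF u] by (intro bdd_belowI2[of _ "\<psi> u - B\<^sup>2"]) force
    then show "0 \<le> \<phi> c" using that by (simp add: \<phi>_def cINF_lower)
    have "\<psi> c - B\<^sup>2 \<le> Inf (\<psi> ` S)" using range[OF that] u by (intro cINF_greatest) force+
    then show "\<phi> c \<le> B\<^sup>2" by (simp add: \<phi>_def)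
  qed
  have step: "\<beta> t * \<phi> (chat t) + (\<Sum>i=1..<t. g i) \<bullet> chat t + g t \<bullet> (chat t - v)
      \<le> \<beta> t * \<phi> v + (\<Sum>i=1..<t. g i) \<bullet> v + 2 * sqrt 2 * k * (sqrt (s (Suc t)) - sqrt (s t))"
    if t: "t \<in> {1..T}" and v: "v \<in> S" for t v
  proof -
    let ?G = "\<Sum>i=1..<t. g i" and ?c = "chat t"
    define n where "n = dual_norm N (v - ?c)"
    define d where "d = \<beta> t * \<phi> ?c + ?G \<bullet> ?c + g t \<bullet> (?c - v) - (\<beta> t * \<phi> v + ?G \<bullet> v)"
    have min: "is_arg_min (\<lambda>c. \<beta> t * \<psi> c + ?G \<bullet> c) (\<lambda>c. c \<in> S) ?c"
      using run[OF t] by (simp add: \<beta>_def inner_sum_left)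
    then have c: "?c \<in> S" by (simp add: is_arg_min_def)
    have n0: "0 \<le> n" unfolding n_def by (rule dual_norm_nonneg[OF N])
    have "g t \<bullet> (?c - v) \<le> N (g t) * n"
      using inner_le_dual_norm[OF N, of "g t" "?c - v"]
      by (simp add: n_def dual_norm_minus_commute[OF N, of ?c])
    \<comment> \<open>Moving from the minimizer to \<open>v\<close> gains at most linearly in
      \<open>n\<close> through the new subgradient and costs quadratically in \<open>n\<close> by
      strong convexity.\<close>
    then have d: "d \<le> N (g t) * n - lam * \<beta> t / 2 * n\<^sup>2"
      using strongly_convex_arg_min[OF sc beta_nonneg min v]
      by (simp add: d_def \<phi>_def n_def algebra_simps)
    have "n\<^sup>2 \<le> k\<^sup>2"
      using diam[OF v c] lam q(1)
      by (simp add: k_def n_def q(4) power_divide power_mult_distrib field_simps)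
    then have nk: "n \<le> k" using k by (rule_tac power2_le_imp_le) auto
    have lin: "d \<le> k * N (g t)"
    proof -
      have "0 \<le> lam * \<beta> t / 2 * n\<^sup>2" using lam beta_nonneg[of t] by simp
      moreover have "N (g t) * n \<le> N (g t) * k" using nk Npos by (intro mult_left_mono) auto
      ultimately show ?thesis using d by (simp add: mult.commute)
    qed
    \<comment> \<open>The objective of round \<open>t\<close> has strong convexity modulus
      \<open>\<gamma>\<close>. Completing the square bounds the gain by
      \<open>(N (g t))\<^sup>2 / (2 * \<gamma>)\<close> for every \<open>n\<close>, and
      \<open>1 / (2 * \<gamma>)\<close> is exactly \<open>k / sqrt (s t)\<close>.\<close>
    have quad: "d \<le> k * (N (g t))\<^sup>2 / sqrt (s t)" if "s t > 0"
    proof -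
      define \<gamma> where "\<gamma> = lam * \<beta> t"
      have "\<gamma> = q * sqrt lam * sqrt (s t) / B"
      proof -
        have "lam = sqrt lam * sqrt lam" using lam by simp
        then show ?thesis using lam B unfolding \<gamma>_def beta by (simp add: field_simps)
      qed
      then have gam: "\<gamma> > 0" "k / sqrt (s t) = 1 / (2 * \<gamma>)"
        using q B lam that by (simp_all add: k_def)
      have "0 \<le> (N (g t) - \<gamma> * n)\<^sup>2" by simp
      then have "N (g t) * n - \<gamma> / 2 * n\<^sup>2 \<le> (N (g t))\<^sup>2 * (1 / (2 * \<gamma>))"
        using gam by (simp add: field_simps power2_eq_square)
      then show ?thesis using d unfolding gam(2)[symmetric] by (simp add: \<gamma>_def mult.commute)
    qed
    have "d \<le> 2 * sqrt 2 * k * (sqrt (s t + (N (g t))\<^sup>2) - sqrt (s t))"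
      using stability_telescope[OF Npos s(1) _ lin quad] k by simp
    then show ?thesis using t by (simp add: d_def s(2))
  qed
  have mono: "\<beta> t \<le> \<beta> (Suc t)" for t
    unfolding beta using q B lam by (intro divide_right_mono mult_left_mono) (auto simp: s(2))
  have chat: "chat t \<in> S" if "t \<in> {1..T}" for t
    using run[OF that] by (simp add: is_arg_min_def)
  have "(\<Sum>t=1..T. g t \<bullet> (chat t - u))
      \<le> \<beta> (Suc T) * \<phi> u + (\<Sum>t=1..T. 2 * sqrt 2 * k * (sqrt (s (Suc t)) - sqrt (s t)))"
    by (rule ftrl_regret[OF chat step beta_nonneg mono phi(1) u])
  also have "\<dots> \<le> \<beta> (Suc T) * B\<^sup>2 + 2 * sqrt 2 * k * sqrt (s (Suc T))"
  proof (intro add_mono mult_left_mono phi u beta_nonneg)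
    have "(\<Sum>t=1..T. sqrt (s (Suc t)) - sqrt (s t)) = sqrt (s (Suc T)) - sqrt (s 1)"
      by (rule sum_Suc_diff) simp
    also have "s 1 = 0" by (simp add: s_def)
    finally show "(\<Sum>t=1..T. 2 * sqrt 2 * k * (sqrt (s (Suc t)) - sqrt (s t)))
        \<le> 2 * sqrt 2 * k * sqrt (s (Suc T))"
      by (simp add: sum_distrib_left[symmetric])
  qed
  \<comment> \<open>The two summands are equal: as \<open>sqrt 2 = q\<^sup>2\<close>, each is
    \<open>q * B * sqrt (s (Suc T)) / sqrt lam\<close>. This balance explains the factor
    \<open>2 powr (1/4)\<close> in \<open>ftrl_beta\<close>.\<close>
  also have "\<dots> = 2 powr (5/4) * B * sqrt (s (Suc T)) / sqrt lam"
    unfolding q(3) beta k_def q(2)[symmetric] using q(1) B lam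
    by (simp add: field_simps power2_eq_square)
  finally show ?thesis by (simp add: s_def atLeastLessThanSuc_atLeastAtMost)
qed

section \<open>The suboptimality loss as a function of the cost vector\<close>

lemma bdd_above_inner_compact:
  fixes X :: "'a::euclidean_space set"
  shows "compact X \<Longrightarrow> bdd_above ((\<lambda>x. c \<bullet> x) ` X)"
  by (intro bounded_imp_bdd_above compact_imp_bounded compact_continuous_image continuous_intros)

lemma subopt_loss_nonneg: "compact X \<Longrightarrow> x \<in> X \<Longrightarrow> 0 \<le> subopt_loss X x c"
  unfolding subopt_loss_def using cSUP_upper[OF _ bdd_above_inner_compact, of x X c] by simp

text \<open>A supremum of linear functions minus a linear function. Convexity serves twice: for
  Jensen's inequality, and for continuity, since a finite convex function on the whole space is
  continuous.\<close>

lemma convex_on_subopt_loss: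
  fixes X :: "'a::euclidean_space set"
  assumes "compact X" "X \<noteq> {}"
  shows "convex_on UNIV (subopt_loss X x)"
proof (intro convex_onI)
  fix s :: real and c c' :: 'a assume s: "0 < s" "s < 1"
  let ?h = "\<lambda>c. SUP x'\<in>X. c \<bullet> x'"
  have "?h ((1 - s) *\<^sub>R c + s *\<^sub>R c') \<le> (1 - s) * ?h c + s * ?h c'"
  proof (rule cSUP_least[OF assms(2)])
    fix x' assume "x' \<in> X"
    then have "c \<bullet> x' \<le> ?h c" "c' \<bullet> x' \<le> ?h c'"
      using assms(1) by (auto intro!: cSUP_upper bdd_above_inner_compact)
    then show "((1 - s) *\<^sub>R c + s *\<^sub>R c') \<bullet> x' \<le> (1 - s) * ?h c + s * ?h c'"
      using s by (simp add: inner_add_left add_mono mult_left_mono)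
  qed
  then show "subopt_loss X x ((1 - s) *\<^sub>R c + s *\<^sub>R c')
      \<le> (1 - s) * subopt_loss X x c + s * subopt_loss X x c'"
    by (simp add: subopt_loss_def inner_add_left algebra_simps)
qed simp

lemma continuous_on_subopt_loss:
  "compact X \<Longrightarrow> X \<noteq> {} \<Longrightarrow> continuous_on S (subopt_loss X x)"
  using convex_on_continuous[OF open_UNIV convex_on_subopt_loss] continuous_on_subset by blast

text \<open>The loss is assumed measurable only for each fixed cost vector, whereas predictions are
  random. For a simple function \<open>G i\<close>, the composite is a finite sum of sections of
  \<open>f\<close> times indicators; continuity in the second argument carries measurability to the
  limit.\<close>

lemma borel_measurable_Caratheodory:
  fixes f :: "'b \<Rightarrow> 'a::euclidean_space \<Rightarrow> real"
  assumes S: "closed S" "convex S" "S \<noteq> {}"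
    and f: "\<And>c. c \<in> S \<Longrightarrow> (\<lambda>y. f y c) \<in> borel_measurable M"
    and cont: "\<And>y. y \<in> space M \<Longrightarrow> continuous_on S (f y)"
    and g: "g \<in> M \<rightarrow>\<^sub>M restrict_space borel S"
  shows "(\<lambda>y. f y (g y)) \<in> borel_measurable M"
proof -
  have g': "g \<in> borel_measurable M" "\<And>y. y \<in> space M \<Longrightarrow> g y \<in> S"
    using g by (auto simp: measurable_restrict_space2_iff)
  \<comment> \<open>The approximating simple functions may leave \<open>S\<close>, where nothing is known about the measurability
    of \<open>f\<close>; projecting them onto \<open>S\<close> preserves the convergence.\<close>
  obtain F where F: "\<And>i. simple_function M (F i)" "\<And>y. y \<in> space M \<Longrightarrow> (\<lambda>i. F i y) \<longlonglongrightarrow> g y"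
    using borel_measurable_implies_sequence_metric[OF g'(1)] by blast
  define G where "G i y = closest_point S (F i y)" for i y
  have GS: "G i y \<in> S" for i y unfolding G_def using S by (intro closest_point_in_set)
  show ?thesis
  proof (rule borel_measurable_LIMSEQ_real)
    fix y assume y: "y \<in> space M"
    have "(\<lambda>i. G i y) \<longlonglongrightarrow> closest_point S (g y)"
      unfolding G_def
      using S by (intro isCont_tendsto_compose[OF _ F(2)[OF y]] continuous_at_closest_point)
    then have "(\<lambda>i. G i y) \<longlonglongrightarrow> g y" using g'(2)[OF y] by (simp add: closest_point_self)
    then show "(\<lambda>i. f y (G i y)) \<longlonglongrightarrow> f y (g y)"
      using GS g'(2)[OF y] by (intro continuous_on_tendsto_compose[OF cont[OF y]]) auto
  next
    fix i
    have sf: "simple_function M (G i)"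
      using simple_function_compose[OF F(1)[of i], of "closest_point S"]
      by (simp add: G_def[abs_def] comp_def)
    have "(\<lambda>y. f y (G i y)) \<in> borel_measurable M
      \<longleftrightarrow> (\<lambda>y. \<Sum>c\<in>G i ` space M. indicator (G i -` {c} \<inter> space M) y * f y c) \<in> borel_measurable M"
    proof (rule measurable_cong)
      fix y assume y: "y \<in> space M"
      have "(\<Sum>c\<in>G i ` space M. indicator (G i -` {c} \<inter> space M) y * f y c)
          = (\<Sum>c\<in>G i ` space M. if c = G i y then f y c else 0)"
        using y by (intro sum.cong) (auto simp: indicator_def)
      also have "\<dots> = f y (G i y)"
        using y simple_functionD(1)[OF sf] by (subst sum.delta) auto
      finally show "f y (G i y) = (\<Sum>c\<in>G i ` space M. indicator (G i -` {c} \<inter> space M) y * f y c)" ..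
    qed
    moreover have "(\<lambda>y. \<Sum>c\<in>G i ` space M. indicator (G i -` {c} \<inter> space M) y * f y c) \<in> borel_measurable M"
      using GS simple_functionD(2)[OF sf]
      by (intro borel_measurable_sum borel_measurable_times f borel_measurable_indicator) auto
    ultimately show "(\<lambda>y. f y (G i y)) \<in> borel_measurable M" by simp
  qed
qed

section \<open>Joint law of the past and one further pair\<close>

text \<open>Independence of the coordinate \<open>t\<close> from those in \<open>J\<close>:
  marginalize to \<open>insert t J\<close>, split off the coordinate \<open>t\<close>, and swap the
  two factors.\<close>

lemma distr_PiM_restrict_component:
  assumes D: "prob_space D" and "finite I" "J \<subseteq> I" "t \<in> I - J"
  shows "distr (PiM I (\<lambda>_. D)) (PiM J (\<lambda>_. D) \<Otimes>\<^sub>M D) (\<lambda>\<omega>. (restrict \<omega> J, \<omega> t))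
    = PiM J (\<lambda>_. D) \<Otimes>\<^sub>M D"
proof -
  interpret D: prob_space D by fact
  interpret product_prob_space "\<lambda>_. D" I by unfold_locales
  interpret J: prob_space "PiM J (\<lambda>_. D)" by (intro prob_space_PiM D)
  interpret JD: pair_sigma_finite "PiM J (\<lambda>_. D)" D by unfold_locales
  let ?J = "PiM J (\<lambda>_. D)" and ?K = "insert t J"
  have K: "?K \<subseteq> I" "t \<notin> J" using assms by auto
  have [measurable]: "(\<lambda>\<omega>. (restrict \<omega> J, \<omega> t)) \<in> PiM ?K (\<lambda>_. D) \<rightarrow>\<^sub>M ?J \<Otimes>\<^sub>M D"
    by (intro measurable_Pair measurable_restrict_subset measurable_component_singleton) auto
  have m2: "(\<lambda>\<omega>. restrict \<omega> ?K) \<in> PiM I (\<lambda>_. D) \<rightarrow>\<^sub>M PiM ?K (\<lambda>_. D)"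
    by (intro measurable_restrict_subset K)
  have m3: "(\<lambda>(d, \<xi>). \<xi>(t := d)) \<in> D \<Otimes>\<^sub>M ?J \<rightarrow>\<^sub>M PiM ?K (\<lambda>_. D)"
    by measurable
  have "distr (PiM I (\<lambda>_. D)) (?J \<Otimes>\<^sub>M D) (\<lambda>\<omega>. (restrict \<omega> J, \<omega> t))
      = distr (distr (PiM I (\<lambda>_. D)) (PiM ?K (\<lambda>_. D)) (\<lambda>\<omega>. restrict \<omega> ?K))
          (?J \<Otimes>\<^sub>M D) (\<lambda>\<omega>. (restrict \<omega> J, \<omega> t))"
    by (subst distr_distr[OF _ m2]) (auto simp: comp_def Int_absorb1 subset_insertI)
  also have "\<dots> = distr (PiM ?K (\<lambda>_. D)) (?J \<Otimes>\<^sub>M D) (\<lambda>\<omega>. (restrict \<omega> J, \<omega> t))"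
    using distr_restrict[OF K(1) \<open>finite I\<close>] by simp
  also have "\<dots> = distr (distr (D \<Otimes>\<^sub>M ?J) (PiM ?K (\<lambda>_. D)) (\<lambda>(d, \<xi>). \<xi>(t := d)))
          (?J \<Otimes>\<^sub>M D) (\<lambda>\<omega>. (restrict \<omega> J, \<omega> t))"
    using distr_pair_PiM_eq_PiM[of J "\<lambda>_. D" t] D by simp
  also have "\<dots> = distr (D \<Otimes>\<^sub>M ?J) (?J \<Otimes>\<^sub>M D) (\<lambda>(d, \<xi>). (\<xi>, d))"
  proof (subst distr_distr[OF _ m3], measurable, rule distr_cong)
    \<comment> \<open>Points of the product over \<open>J\<close> are \<open>undefined\<close>
      outside \<open>J\<close>, so restricting the updated function to \<open>J\<close> gives back
      exactly \<xi>.\<close>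
    fix p assume "p \<in> space (D \<Otimes>\<^sub>M ?J)"
    then show "((\<lambda>\<omega>. (restrict \<omega> J, \<omega> t)) \<circ> (\<lambda>(d, \<xi>). \<xi>(t := d))) p = (case p of (d, \<xi>) \<Rightarrow> (\<xi>, d))"
      using K(2) by (auto simp: space_pair_measure space_PiM PiE_def extensional_restrict fun_upd_def
          restrict_def extensional_def intro!: ext)
  qed auto
  also have "\<dots> = ?J \<Otimes>\<^sub>M D" by (rule JD.distr_pair_swap[symmetric])
  finally show ?thesis .
qed

text \<open>The counterpart for a fresh pair. The common law in both lemmas is what allows the pair
  of round \<open>t\<close> to be exchanged for an independent one.\<close>

lemma distr_PiM_restrict_pair:
  assumes D: "prob_space D" and "finite I" "J \<subseteq> I"
  shows "distr (PiM I (\<lambda>_. D) \<Otimes>\<^sub>M D) (PiM J (\<lambda>_. D) \<Otimes>\<^sub>M D) (\<lambda>(\<omega>, d). (restrict \<omega> J, d))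
    = PiM J (\<lambda>_. D) \<Otimes>\<^sub>M D"
proof -
  interpret D: prob_space D by fact
  interpret product_prob_space "\<lambda>_. D" I by unfold_locales
  have "PiM J (\<lambda>_. D) \<Otimes>\<^sub>M D
      = distr (PiM I (\<lambda>_. D)) (PiM J (\<lambda>_. D)) (\<lambda>\<omega>. restrict \<omega> J) \<Otimes>\<^sub>M distr D D (\<lambda>d. d)"
    using distr_restrict[OF assms(3,2)] by (simp add: distr_id)
  also have "\<dots> = distr (PiM I (\<lambda>_. D) \<Otimes>\<^sub>M D) (PiM J (\<lambda>_. D) \<Otimes>\<^sub>M D) (\<lambda>(\<omega>, d). (restrict \<omega> J, d))"
    using assms(3)
    by (intro pair_measure_distr measurable_restrict_subset) (auto simp: distr_id D.sigma_finite_measure_axioms)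
  finally show ?thesis ..
qed

section \<open>Online-to-batch conversion\<close>

lemma online_to_batch:
  fixes \<Theta> :: "'a::euclidean_space set"
  assumes \<Theta>: "closed \<Theta>" "convex \<Theta>"
    and D: "prob_space D"
    and XD: "\<And>X x. (X, x) \<in> space D \<Longrightarrow> X \<noteq> {} \<and> compact X \<and> x \<in> X"
    and meas: "\<And>c. c \<in> \<Theta> \<Longrightarrow> (\<lambda>(X, x). subopt_loss X x c) \<in> borel_measurable D"
    and T: "1 \<le> T"
    and A: "online_algorithm \<Theta> D T A"
    and cstar: "cstar \<in> \<Theta>" "integrable D (\<lambda>(X, x). subopt_loss X x cstar)"
    and reg: "AE \<omega> in PiM {1..T} (\<lambda>_. D). regret_sub A cstar T \<omega> \<le> b"
  shows "(\<integral>(\<omega>, X, x). subopt_loss X x (avg_prediction A T \<omega>) \<partial>(PiM {1..T} (\<lambda>_. D) \<Otimes>\<^sub>M D))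
      \<le> (\<integral>(X, x). subopt_loss X x cstar \<partial>D)
        + (\<integral>\<omega>. regret_sub A cstar T \<omega> / real T \<partial>(PiM {1..T} (\<lambda>_. D)))"
    and "integrable (PiM {1..T} (\<lambda>_. D)) (regret_sub A cstar T)"
proof -
  interpret D: prob_space D by fact
  let ?P = "PiM {1..T} (\<lambda>_. D)" and ?Q = "\<lambda>t::nat. PiM {1..<t} (\<lambda>_. D) \<Otimes>\<^sub>M D"
  interpret P: prob_space ?P by (intro prob_space_PiM D)
  define L where "L d c = subopt_loss (fst d) (snd d) c" for d :: "'a set \<times> 'a" and c
  \<comment> \<open>\<open>h t\<close> is the loss of round \<open>t\<close> as a function of the
    past and one pair. Evaluated at the pair of round \<open>t\<close> it becomes
    \<open>a t\<close>, at a fresh pair \<open>p t\<close>.\<close>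
  define h where "h t = (\<lambda>(\<xi>, d). L d (A t \<xi>))" for t
  define a where "a t \<omega> = L (\<omega> t) (prediction A \<omega> t)" for t \<omega>
  define s where "s t \<omega> = L (\<omega> t) cstar" for t :: nat and \<omega>
  define p where "p t = (\<lambda>(\<omega>, d). L d (prediction A \<omega> t))" for t
  have XD': "fst d \<noteq> {}" "compact (fst d)" "snd d \<in> fst d" if "d \<in> space D" for d
    using XD[of "fst d" "snd d"] that by auto
  have L0: "0 \<le> L d c" if "d \<in> space D" for d c
    using XD'[OF that] by (simp add: L_def subopt_loss_nonneg)
  have Lm: "(\<lambda>d. L d c) \<in> borel_measurable D" if "c \<in> \<Theta>" for c
    using meas[OF that] by (simp add: L_def case_prod_beta')
  have Ls: "integrable D (\<lambda>d. L d cstar)"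
    using cstar(2) by (simp add: L_def case_prod_beta')
  have hm: "h t \<in> borel_measurable (?Q t)" if t: "t \<in> {1..T}" for t
  proof -
    have At: "A t \<in> PiM {1..<t} (\<lambda>_. D) \<rightarrow>\<^sub>M restrict_space borel \<Theta>"
      using A t by (simp add: online_algorithm_def)
    have "(\<lambda>y. L (snd y) ((A t \<circ> fst) y)) \<in> borel_measurable (?Q t)"
    proof (rule borel_measurable_Caratheodory[OF \<Theta>])
      show "\<Theta> \<noteq> {}" using cstar by auto
      show "(\<lambda>y. L (snd y) c) \<in> borel_measurable (?Q t)" if "c \<in> \<Theta>" for c
        using measurable_compose[OF measurable_snd Lm[OF that]] .
      show "continuous_on \<Theta> (L (snd y))" if "y \<in> space (?Q t)" for y
        using XD'[of "snd y"] that
        by (auto simp: L_def[abs_def] space_pair_measure intro!: continuous_on_subopt_loss)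
      show "A t \<circ> fst \<in> ?Q t \<rightarrow>\<^sub>M restrict_space borel \<Theta>"
        by (rule measurable_comp[OF measurable_fst At])
    qed
    then show ?thesis by (simp add: h_def case_prod_beta')
  qed
  have m1: "(\<lambda>\<omega>. (restrict \<omega> {1..<t}, \<omega> t)) \<in> ?P \<rightarrow>\<^sub>M ?Q t" if "t \<in> {1..T}" for t
    using that
    by (intro measurable_Pair measurable_restrict_subset measurable_component_singleton) auto
  have m2: "(\<lambda>(\<omega>, d). (restrict \<omega> {1..<t}, d)) \<in> ?P \<Otimes>\<^sub>M D \<rightarrow>\<^sub>M ?Q t" if "t \<in> {1..T}" for t
    unfolding case_prod_beta' using that
    by (intro measurable_Pair measurable_compose[OF measurable_fst] measurable_restrict_subset measurable_snd) auto
  have ah: "a t = (\<lambda>\<omega>. h t (restrict \<omega> {1..<t}, \<omega> t))" for t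
    by (simp add: a_def[abs_def] h_def prediction_def)
  have ph: "p t = (\<lambda>y. h t ((\<lambda>(\<omega>, d). (restrict \<omega> {1..<t}, d)) y))" for t
    by (simp add: p_def h_def prediction_def case_prod_beta')
  have d1: "distr ?P (?Q t) (\<lambda>\<omega>. (restrict \<omega> {1..<t}, \<omega> t)) = ?Q t" if "t \<in> {1..T}" for t
    using that by (intro distr_PiM_restrict_component[OF D]) auto
  have d2: "distr (?P \<Otimes>\<^sub>M D) (?Q t) (\<lambda>(\<omega>, d). (restrict \<omega> {1..<t}, d)) = ?Q t"
    if "t \<in> {1..T}" for t
    using that by (intro distr_PiM_restrict_pair[OF D]) auto
  have s_distr: "distr ?P D (\<lambda>\<omega>. \<omega> t) = D" if "t \<in> {1..T}" for t
    using that D by (intro distr_PiM_component)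
  have s_int: "integrable ?P (s t)" and s_eq: "(\<integral>\<omega>. s t \<omega> \<partial>?P) = (\<integral>d. L d cstar \<partial>D)"
    if t: "t \<in> {1..T}" for t
  proof -
    have m: "(\<lambda>\<omega>. \<omega> t) \<in> ?P \<rightarrow>\<^sub>M D" using t by (intro measurable_component_singleton)
    show "integrable ?P (s t)"
      using integrable_distr_eq[OF m Lm[OF cstar(1)]] Ls unfolding s_distr[OF t] s_def[abs_def] by blast
    show "(\<integral>\<omega>. s t \<omega> \<partial>?P) = (\<integral>d. L d cstar \<partial>D)"
      using integral_distr[OF m Lm[OF cstar(1)]] unfolding s_distr[OF t] s_def by simp
  qed
  have regret: "regret_sub A cstar T \<omega> = (\<Sum>t=1..T. a t \<omega> - s t \<omega>)" for \<omega>
    by (simp add: regret_sub_def a_def s_def L_def)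
  have a0: "0 \<le> a t \<omega>" if "\<omega> \<in> space ?P" "t \<in> {1..T}" for \<omega> t
    using that by (auto simp: a_def space_PiM intro!: L0)
  have a_int: "integrable ?P (a t)" if t: "t \<in> {1..T}" for t
  \<comment> \<open>An upper bound on the regret is enough here: losses are nonnegative, so each
    \<open>a t\<close> is at most their sum, which is the regret plus the total loss of
    \<open>cstar\<close>.\<close>
  proof (rule Bochner_Integration.integrable_bound)
    show "integrable ?P (\<lambda>\<omega>. b + (\<Sum>t=1..T. s t \<omega>))"
      by (intro Bochner_Integration.integrable_add Bochner_Integration.integrable_sum s_int P.integrable_const)
    show "a t \<in> borel_measurable ?P"
      unfolding ah using measurable_compose[OF m1[OF t] hm[OF t]] .
    show "AE \<omega> in ?P. norm (a t \<omega>) \<le> norm (b + (\<Sum>t=1..T. s t \<omega>))"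
      using reg AE_space
    proof eventually_elim
      case (elim \<omega>)
      have "a t \<omega> \<le> (\<Sum>t=1..T. a t \<omega>)"
        using t a0[OF elim(2)] by (intro member_le_sum) auto
      also have "\<dots> \<le> b + (\<Sum>t=1..T. s t \<omega>)"
        using elim(1) by (simp add: regret sum_subtractf)
      finally show ?case using a0[OF elim(2) t] by simp
    qed
  qed
  \<comment> \<open>Both integrals equal the integral of \<open>h t\<close> over
    \<open>?Q t\<close>, the common law found above.\<close>
  have p_int: "integrable (?P \<Otimes>\<^sub>M D) (p t)"
    and p_eq: "(\<integral>y. p t y \<partial>(?P \<Otimes>\<^sub>M D)) = (\<integral>\<omega>. a t \<omega> \<partial>?P)" if t: "t \<in> {1..T}" for t
  proof -
    have "integrable (?Q t) (h t)"
      using a_int[OF t] integrable_distr_eq[OF m1[OF t] hm[OF t]] unfolding ah d1[OF t] by blast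
    then show "integrable (?P \<Otimes>\<^sub>M D) (p t)"
      using integrable_distr_eq[OF m2[OF t] hm[OF t]] unfolding ph d2[OF t] by blast
    show "(\<integral>y. p t y \<partial>(?P \<Otimes>\<^sub>M D)) = (\<integral>\<omega>. a t \<omega> \<partial>?P)"
      using integral_distr[OF m1[OF t] hm[OF t]] integral_distr[OF m2[OF t] hm[OF t]]
      unfolding ah ph d1[OF t] d2[OF t] by simp
  qed
  show int: "integrable ?P (regret_sub A cstar T)"
    unfolding regret[abs_def]
    by (intro Bochner_Integration.integrable_sum Bochner_Integration.integrable_diff a_int s_int)
  have "(\<integral>(\<omega>, X, x). subopt_loss X x (avg_prediction A T \<omega>) \<partial>(?P \<Otimes>\<^sub>M D))
      = (\<integral>(\<omega>, d). L d (avg_prediction A T \<omega>) \<partial>(?P \<Otimes>\<^sub>M D))"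
    by (simp add: L_def case_prod_beta')
  also have "\<dots> \<le> (\<integral>y. (\<Sum>t=1..T. p t y) / real T \<partial>(?P \<Otimes>\<^sub>M D))"
  \<comment> \<open>Integrability and nonnegativity are required of the upper bound only. If the
    left integrand were not integrable, its integral would be 0 by convention, and the inequality
    would still hold.\<close>
  proof (rule integral_mono')
    show "integrable (?P \<Otimes>\<^sub>M D) (\<lambda>y. (\<Sum>t=1..T. p t y) / real T)"
      by (intro integrable_divide Bochner_Integration.integrable_sum p_int)
    fix y assume y: "y \<in> space (?P \<Otimes>\<^sub>M D)"
    obtain \<omega> d where yd: "y = (\<omega>, d)" by (cases y)
    have d: "d \<in> space D" using y by (simp add: yd space_pair_measure)
    have "L d (\<Sum>t=1..T. (1 / real T) *\<^sub>R prediction A \<omega> t)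
        \<le> (\<Sum>t=1..T. 1 / real T * L d (prediction A \<omega> t))"
      using T XD'[OF d] convex_on_subopt_loss[of "fst d" "snd d"] unfolding L_def
      by (intro convex_on_sum) auto
    then show "(case y of (\<omega>, d) \<Rightarrow> L d (avg_prediction A T \<omega>)) \<le> (\<Sum>t=1..T. p t y) / real T"
      by (simp add: yd p_def avg_prediction_def scaleR_sum_right sum_divide_distrib)
    show "0 \<le> (\<Sum>t=1..T. p t y) / real T"
      using L0[OF d] by (auto simp: yd p_def intro!: sum_nonneg divide_nonneg_nonneg)
  qed
  also have "\<dots> = (\<Sum>t=1..T. \<integral>\<omega>. a t \<omega> \<partial>?P) / real T"
    by (simp only: Bochner_Integration.integral_divide_zero Bochner_Integration.integral_sum[OF p_int]
        p_eq cong: sum.cong)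
  also have "\<dots> = (\<integral>d. L d cstar \<partial>D) + (\<integral>\<omega>. regret_sub A cstar T \<omega> / real T \<partial>?P)"
  proof -
    have "(\<integral>\<omega>. regret_sub A cstar T \<omega> \<partial>?P) = (\<Sum>t=1..T. (\<integral>\<omega>. a t \<omega> \<partial>?P) - (\<integral>d. L d cstar \<partial>D))"
      using a_int s_int s_eq unfolding regret
      by (subst Bochner_Integration.integral_sum) (auto intro!: sum.cong)
    then show ?thesis using T by (simp add: sum_subtractf field_simps)
  qed
  finally show "(\<integral>(\<omega>, X, x). subopt_loss X x (avg_prediction A T \<omega>) \<partial>(?P \<Otimes>\<^sub>M D))
      \<le> (\<integral>(X, x). subopt_loss X x cstar \<partial>D) + (\<integral>\<omega>. regret_sub A cstar T \<omega> / real T \<partial>?P)"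
    by (simp add: L_def case_prod_beta')
qed

section \<open>FTRL applied to the suboptimality losses\<close>

lemma ftrl_regret_sub:
  fixes \<Theta> :: "'a::euclidean_space set"
  assumes N: "is_norm N" and pos: "lam > 0" "B > 0" "K > 0"
    and sc: "strongly_convex_on (dual_norm N) lam \<Theta> \<psi>"
    and diam: "\<And>c c'. c \<in> \<Theta> \<Longrightarrow> c' \<in> \<Theta> \<Longrightarrow> 2 powr (5/2) * lam * (dual_norm N (c - c'))\<^sup>2 \<le> B\<^sup>2"
    and range: "\<And>c c'. c \<in> \<Theta> \<Longrightarrow> c' \<in> \<Theta> \<Longrightarrow> \<psi> c - \<psi> c' \<le> B\<^sup>2"
    and X: "\<And>t. t \<in> {1..T} \<Longrightarrow> compact (fst (\<omega> t))"
    and run: "is_ftrl_run \<Theta> \<psi> (ftrl_beta N lam B (\<lambda>t. xhat t - snd (\<omega> t))) T \<omega> (prediction A \<omega>) xhat"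
    and K: "\<And>t. t \<in> {1..T} \<Longrightarrow> N (xhat t - snd (\<omega> t)) \<le> K"
    and u: "u \<in> \<Theta>"
  shows "regret_sub A u T \<omega> \<le> 2 powr (5/4) * (K * B * sqrt (real T) / sqrt lam)"
proof -
  let ?g = "\<lambda>t. xhat t - snd (\<omega> t)" and ?c = "prediction A \<omega>"
  \<comment> \<open>\<open>?g t\<close> is a subgradient of the loss at \<open>?c t\<close>:
    \<open>xhat t\<close> attains the maximum for \<open>?c t\<close> and is one candidate in the
    maximum for \<open>u\<close>.\<close>
  have "subopt_loss (fst (\<omega> t)) (snd (\<omega> t)) (?c t) - subopt_loss (fst (\<omega> t)) (snd (\<omega> t)) u
      \<le> ?g t \<bullet> (?c t - u)" if t: "t \<in> {1..T}" for t
  proof -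
    have mx: "xhat t \<in> fst (\<omega> t)" "\<And>y. y \<in> fst (\<omega> t) \<Longrightarrow> ?c t \<bullet> y \<le> ?c t \<bullet> xhat t"
      using run t by (auto simp: is_ftrl_run_def is_arg_max_linorder)
    have "(SUP x'\<in>fst (\<omega> t). ?c t \<bullet> x') \<le> ?c t \<bullet> xhat t"
      using mx by (intro cSUP_least) auto
    moreover have "u \<bullet> xhat t \<le> (SUP x'\<in>fst (\<omega> t). u \<bullet> x')"
      by (intro cSUP_upper mx bdd_above_inner_compact X t)
    ultimately show ?thesis
      by (simp add: subopt_loss_def inner_diff_left inner_diff_right inner_commute)
  qed
  then have "regret_sub A u T \<omega> \<le> (\<Sum>t=1..T. ?g t \<bullet> (?c t - u))"
    unfolding regret_sub_def by (rule sum_mono)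
  also have "\<dots> \<le> 2 powr (5/4) * B * sqrt (\<Sum>t=1..T. (N (?g t))\<^sup>2) / sqrt lam"
    using run unfolding is_ftrl_run_def
    by (intro ftrl_adaptive_regret[OF N pos(1,2) sc diam range _ u]) auto
  also have "\<dots> \<le> 2 powr (5/4) * B * sqrt (real T * K\<^sup>2) / sqrt lam"
  proof -
    have "(\<Sum>t=1..T. (N (?g t))\<^sup>2) \<le> (\<Sum>t=1..T. K\<^sup>2)"
      using K N by (intro sum_mono power_mono) (auto simp: is_norm_def)
    then show ?thesis
      using pos by (intro divide_right_mono mult_left_mono real_sqrt_le_mono) auto
  qed
  finally show ?thesis using pos by (simp add: real_sqrt_mult algebra_simps)
qed

theorem theorem4p3:
  fixes \<Theta> :: "(real ^ 'n) set"
    and D :: "((real ^ 'n) set \<times> (real ^ 'n)) measure"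
    and T :: nat
    and A :: "nat \<Rightarrow> (nat \<Rightarrow> (real ^ 'n) set \<times> (real ^ 'n)) \<Rightarrow> real ^ 'n"
    and cstar :: "real ^ 'n"
  assumes "\<Theta> \<noteq> {}" and "closed \<Theta>" and "convex \<Theta>" and "0 \<notin> \<Theta>"
    and "prob_space D"
    and "\<And>X x. (X, x) \<in> space D \<Longrightarrow> X \<noteq> {} \<and> compact X \<and> x \<in> X"
    and "\<And>c. c \<in> \<Theta> \<Longrightarrow> (\<lambda>(X, x). subopt_loss X x c) \<in> borel_measurable D"
    and "1 \<le> T"
    and "online_algorithm \<Theta> D T A"
    and "cstar \<in> \<Theta>"
    and "integrable D (\<lambda>(X, x). subopt_loss X x cstar)"
  shows
    "((\<exists>b. AE \<omega> in PiM {1..T} (\<lambda>_. D). regret_sub A cstar T \<omega> \<le> b) \<longrightarrow>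
        (\<integral>(\<omega>, X, x). subopt_loss X x (avg_prediction A T \<omega>) \<partial>(PiM {1..T} (\<lambda>_. D) \<Otimes>\<^sub>M D))
          \<le> (\<integral>(X, x). subopt_loss X x cstar \<partial>D)
             + (\<integral>\<omega>. regret_sub A cstar T \<omega> / real T \<partial>(PiM {1..T} (\<lambda>_. D)))) \<and>
     (\<forall>(N :: real ^ 'n \<Rightarrow> real) (lam::real) (B::real) (K::real) (\<psi> :: real ^ 'n \<Rightarrow> real)
        (xhat :: (nat \<Rightarrow> (real ^ 'n) set \<times> (real ^ 'n)) \<Rightarrow> nat \<Rightarrow> real ^ 'n).
        is_norm N \<and> lam > 0 \<and> B > 0 \<and> K > 0 \<and>
        \<psi> differentiable_on \<Theta> \<and> strongly_convex_on (dual_norm N) lam \<Theta> \<psi> \<and>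
        (\<forall>c\<in>\<Theta>. \<forall>c'\<in>\<Theta>. 2 powr (5/2) * lam * (dual_norm N (c - c'))\<^sup>2 \<le> B\<^sup>2) \<and>
        (\<forall>c\<in>\<Theta>. \<forall>c'\<in>\<Theta>. \<psi> c - \<psi> c' \<le> B\<^sup>2) \<and>
        (\<forall>\<omega>\<in>space (PiM {1..T} (\<lambda>_. D)).
           is_ftrl_run \<Theta> \<psi> (ftrl_beta N lam B (\<lambda>t. xhat \<omega> t - snd (\<omega> t))) T \<omega>
             (prediction A \<omega>) (xhat \<omega>)) \<and>
        (AE \<omega> in PiM {1..T} (\<lambda>_. D). \<forall>t\<in>{1..T}. N (xhat \<omega> t - snd (\<omega> t)) \<le> K) \<longrightarrow>
        (\<integral>(\<omega>, X, x). subopt_loss X x (avg_prediction A T \<omega>) \<partial>(PiM {1..T} (\<lambda>_. D) \<Otimes>\<^sub>M D))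
          - (\<integral>(X, x). subopt_loss X x cstar \<partial>D)
          \<le> 2 powr (5/4) * (K * B / sqrt (real T * lam)))"

proof (intro conjI impI allI, elim exE)
  fix b assume "AE \<omega> in PiM {1..T} (\<lambda>_. D). regret_sub A cstar T \<omega> \<le> b"
  from online_to_batch(1)[OF assms(2,3,5-11) this]
  show "(\<integral>(\<omega>, X, x). subopt_loss X x (avg_prediction A T \<omega>) \<partial>(PiM {1..T} (\<lambda>_. D) \<Otimes>\<^sub>M D))
      \<le> (\<integral>(X, x). subopt_loss X x cstar \<partial>D)
        + (\<integral>\<omega>. regret_sub A cstar T \<omega> / real T \<partial>(PiM {1..T} (\<lambda>_. D)))" .
next
  fix N :: "real ^ 'n \<Rightarrow> real" and lam B K :: real and \<psi> :: "real ^ 'n \<Rightarrow> real"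
    and xhat :: "(nat \<Rightarrow> (real ^ 'n) set \<times> (real ^ 'n)) \<Rightarrow> nat \<Rightarrow> real ^ 'n"
  let ?P = "PiM {1..T} (\<lambda>_. D)"
  interpret D: prob_space D by fact
  interpret P: prob_space ?P by (intro prob_space_PiM assms(5))
  assume H: "is_norm N \<and> lam > 0 \<and> B > 0 \<and> K > 0 \<and>
        \<psi> differentiable_on \<Theta> \<and> strongly_convex_on (dual_norm N) lam \<Theta> \<psi> \<and>
        (\<forall>c\<in>\<Theta>. \<forall>c'\<in>\<Theta>. 2 powr (5/2) * lam * (dual_norm N (c - c'))\<^sup>2 \<le> B\<^sup>2) \<and>
        (\<forall>c\<in>\<Theta>. \<forall>c'\<in>\<Theta>. \<psi> c - \<psi> c' \<le> B\<^sup>2) \<and>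
        (\<forall>\<omega>\<in>space ?P.
           is_ftrl_run \<Theta> \<psi> (ftrl_beta N lam B (\<lambda>t. xhat \<omega> t - snd (\<omega> t))) T \<omega>
             (prediction A \<omega>) (xhat \<omega>)) \<and>
        (AE \<omega> in ?P. \<forall>t\<in>{1..T}. N (xhat \<omega> t - snd (\<omega> t)) \<le> K)"
  \<comment> \<open>A deterministic bound on the regret does double duty: it supplies the
    boundedness needed for the conversion, including integrability of the regret, and it bounds the
    expected regret.\<close>
  define C where "C = 2 powr (5/4) * (K * B * sqrt (real T) / sqrt lam)"
  have "AE \<omega> in ?P. \<forall>t\<in>{1..T}. N (xhat \<omega> t - snd (\<omega> t)) \<le> K" using H by blast
  then have reg: "AE \<omega> in ?P. regret_sub A cstar T \<omega> \<le> C"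
    using AE_space
  proof eventually_elim
    case (elim \<omega>)
    have "compact (fst (\<omega> t))" if "t \<in> {1..T}" for t
    proof -
      have "\<omega> t \<in> space D" using elim(2) that by (auto simp: space_PiM)
      then show ?thesis using assms(6)[of "fst (\<omega> t)" "snd (\<omega> t)"] by simp
    qed
    then show ?case
      unfolding C_def using H elim assms(10) by (intro ftrl_regret_sub[where xhat = "xhat \<omega>"]) auto
  qed
  note otb = online_to_batch[OF assms(2,3,5-11) reg]
  have "(\<integral>\<omega>. regret_sub A cstar T \<omega> \<partial>?P) \<le> C"
    using otb(2) reg by (rule P.integral_le_const)
  then have "(\<integral>\<omega>. regret_sub A cstar T \<omega> / real T \<partial>?P) \<le> C / real T"
    using assms(8) by (simp add: divide_right_mono)
  also have "C / real T = 2 powr (5/4) * (K * B / sqrt (real T * lam))"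
  proof -
    have "C / real T = 2 powr (5/4) * (K * B * (sqrt (real T) / real T) / sqrt lam)"
      by (simp add: C_def)
    also have "sqrt (real T) / real T = 1 / sqrt (real T)"
      using assms(8) by (simp add: field_simps)
    finally show ?thesis by (simp add: real_sqrt_mult)
  qed
  finally show "(\<integral>(\<omega>, X, x). subopt_loss X x (avg_prediction A T \<omega>) \<partial>(?P \<Otimes>\<^sub>M D))
      - (\<integral>(X, x). subopt_loss X x cstar \<partial>D) \<le> 2 powr (5/4) * (K * B / sqrt (real T * lam))"
    using otb(1) by linarith
qed

end
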